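(* Let $v,d\ge1$ be integers and let $\Phi\colon\mathbb{S}^d_+\to\mathbb{R}^{d\times d}$ satisfy $\Phi(RXR^\top)=R\,\Phi(X)\,R^\top$ for all $X\in\mathbb{S}^d_+$ and all $R\in\mathbb{O}^d$. Define $\mathscr{U}_{\mathsf R}\colon\mathbb{R}^{v\times d}\to\mathbb{R}^{v\times d}$ by $\mathscr{U}_{\mathsf R}(D)=D\,\Phi(D^\top D)$. Then $$\mathscr{U}_{\mathsf R}(PDR^\top)=P\,\mathscr{U}_{\mathsf R}(D)\,R^\top$$ for all $D\in\mathbb{R}^{v\times d}$, all permutation matrices $P\in\mathbb{P}^v$, and all $R\in\mathbb{O}^d$.
   Context: $\mathbb{S}^d_+$ is the set of real symmetric positive semidefinite $d\times d$ matrices, $\mathbb{O}^d$ the set of $d\times d$ orthogonal matrices, and $\mathbb{P}^v$ the set of $v\times v$ permutation matrices. *)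

theory Defs
  imports "HOL-Analysis.Analysis"
begin

definition psd_matrices :: "(real ^ 'd ^ 'd) set" where
  "psd_matrices = {X. transpose X = X \<and> (\<forall>x. 0 \<le> x \<bullet> (X *v x))}"

definition orthogonal_matrices :: "(real ^ 'd ^ 'd) set" where
  "orthogonal_matrices = {R. orthogonal_matrix R}"

definition permutation_matrices :: "(real ^ 'v ^ 'v) set" where
  "permutation_matrices =
    {P. \<exists>p. p permutes (UNIV :: 'v set) \<and> P = (\<chi> i j. if i = p j then 1 else 0)}"

(* A map defined only on the positive semidefinite matrices is represented by a total function
   Phi whose values elsewhere are arbitrary.  The map below only evaluates Phi at the positive
   semidefinite matrix transpose D ** D.  D :: real ^ 'd ^ 'v has CARD('v) rows and
   CARD('d) columns. *)
definition update_R ::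
  "(real ^ 'd ^ 'd \<Rightarrow> real ^ 'd ^ 'd) \<Rightarrow> real ^ 'd ^ 'v \<Rightarrow> real ^ 'd ^ 'v" where
  "update_R \<Phi> D = D ** \<Phi> (transpose D ** D)"

end

theory Submission
  imports Defs
begin

text \<open>The argument of \<open>\<Phi>\<close> is the Gram matrix G of the columns of D.
  Replacing D by P D R^T turns G into R (D^T P^T P D) R^T = R G R^T, since P^T P = I
  (\<open>permutation_matrix_transpose_mul\<close>). As G is positive semidefinite
  (\<open>gram_in_psd_matrices\<close>), equivariance yields R \<Phi>(G) R^T, and its left factor R
  cancels against the R^T that ends P D R^T.\<close>

lemma gram_in_psd_matrices:
  fixes D :: "real ^ 'd ^ 'v"
  shows "transpose D ** D \<in> psd_matrices"
proof -
  have "x \<bullet> ((transpose D ** D) *v x) = (D *v x) \<bullet> (D *v x)" for x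
    by (metis dot_lmul_matrix inner_commute matrix_vector_mul_assoc transpose_matrix_vector)
  then show ?thesis
    by (simp add: psd_matrices_def matrix_transpose_mul)
qed

text \<open>Column j of P is the standard basis vector at index \<open>p j\<close>; injectivity of p
  makes the columns orthonormal.\<close>

lemma permutation_matrix_transpose_mul:
  assumes "P \<in> permutation_matrices"
  shows "transpose P ** P = mat 1"
proof -
  obtain p where p: "p permutes UNIV" "P = (\<chi> i j. if i = p j then 1 else 0)"
    using assms by (auto simp: permutation_matrices_def)
  have "(transpose P ** P) $ i $ j = (if i = j then 1 else 0)" for i j
  proof -
    \<comment> \<open>The summand is P_ki P_kj, whose first factor vanishes unless k =
      \<open>p i\<close>; this form lets the sum collapse to that single index.\<close>
    have "(transpose P ** P) $ i $ j = (\<Sum>k\<in>UNIV. if k = p i then (if p i = p j then 1 else 0) else 0)"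
      unfolding p(2) matrix_matrix_mult_def transpose_def vec_lambda_beta
      by (intro sum.cong) simp_all
    then show ?thesis
      using permutes_inj[OF p(1)] by (simp add: inj_eq)
  qed
  then show ?thesis
    by (simp add: vec_eq_iff mat_def)
qed

theorem theorem3p2:
  fixes \<Phi> :: "real ^ 'd ^ 'd \<Rightarrow> real ^ 'd ^ 'd"
  assumes equivariant: "\<forall>X \<in> psd_matrices. \<forall>R \<in> orthogonal_matrices.
    \<Phi> (R ** X ** transpose R) = R ** \<Phi> X ** transpose R"
  shows "\<forall>D :: real ^ 'd ^ 'v. \<forall>P \<in> permutation_matrices. \<forall>R \<in> orthogonal_matrices.
    update_R \<Phi> (P ** D ** transpose R) = P ** update_R \<Phi> D ** transpose R"
proof (intro allI ballI)
  fix D :: "real ^ 'd ^ 'v" and P :: "real ^ 'v ^ 'v" and R :: "real ^ 'd ^ 'd"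
  assume P: "P \<in> permutation_matrices" and R: "R \<in> orthogonal_matrices"
  let ?G = "transpose D ** D"
  have RR: "transpose R ** R = mat 1"
    using R by (simp add: orthogonal_matrices_def orthogonal_matrix_def)
  have "transpose (P ** D ** transpose R) ** (P ** D ** transpose R)
      = R ** transpose D ** (transpose P ** P) ** D ** transpose R"
    by (simp add: matrix_transpose_mul matrix_mul_assoc)
  also have "\<dots> = R ** ?G ** transpose R"
    by (simp add: permutation_matrix_transpose_mul[OF P] matrix_mul_assoc)
  \<comment> \<open>Equivariance is applied at X = \<open>?G\<close>, so only values of
    \<open>\<Phi>\<close> on positive semidefinite matrices enter.\<close>
  finally have "update_R \<Phi> (P ** D ** transpose R)
      = P ** D ** transpose R ** (R ** \<Phi> ?G ** transpose R)"
    using equivariant[rule_format, OF gram_in_psd_matrices[of D] R] by (simp add: update_R_def)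
  \<comment> \<open>Regrouping makes R^T from the argument meet R from the output of
    \<open>\<Phi>\<close>, ready for \<open>RR\<close>.\<close>
  also have "\<dots> = P ** D ** (transpose R ** R) ** \<Phi> ?G ** transpose R"
    by (simp add: matrix_mul_assoc)
  also have "\<dots> = P ** update_R \<Phi> D ** transpose R"
    by (simp add: RR update_R_def matrix_mul_assoc)
  finally show "update_R \<Phi> (P ** D ** transpose R) = P ** update_R \<Phi> D ** transpose R" .
qed

end
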